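(* Let $N_{\rm a}\ge 1$ be an integer, $p\in[0,1]$ and $\alpha>0$ real. Consider a 2-round multi-agent debate with $N_{\rm a}$ agents in each round. In round 1 the agents' answers are independent and each is correct with probability $p$; let $N^{(1)}_{\rm cor}$ be the number of correct answers in round 1, with possible values denoted $j\in\{0,1,\dots,N_{\rm a}\}$. Conditionally on $N^{(1)}_{\rm cor}=j$, the answers of the $N_{\rm a}$ agents in round 2 are independent and each is correct with probability $e^{-\alpha(N_{\rm a}-j)}=e^{\alpha(j-N_{\rm a})}$; let $N^{(2)}_{\rm cor}$ be the number of correct answers in round 2. The final answer is deemed correct when $N^{(2)}_{\rm cor}>\frac{N_{\rm a}}{2}$. Put $$\omega_j=\binom{N_{\rm a}}{j}p^j(1-p)^{N_{\rm a}-j},\qquad j^*=\left\lfloor N_{\rm a}-\frac{\ln 2}{\alpha}\right\rfloor .$$ Then the probability that the final answer is correct is bounded as follows, according to two cases. (i) In the case $e^{\alpha(j-N_{\rm a})}<\frac12$: $$P\left(N^{(2)}_{\rm cor}>\frac{N_{\rm a}}{2}\right)\le \sum_{j=0}^{j^*}\omega_j\exp\left(-2N_{\rm a}\left(\frac12-e^{\alpha(j-N_{\rm a})}\right)^2\right)+\sum_{j=j^*+1}^{N_{\rm a}}\omega_j ,$$ the corresponding lower bound being the trivial bound $0$. (ii) In the case $e^{\alpha(j-N_{\rm a})}\ge\frac12$: $$P\left(N^{(2)}_{\rm cor}>\frac{N_{\rm a}}{2}\right)\ge \sum_{j=j^*+1}^{N_{\rm a}}\omega_j\left(1-\exp\left(-2N_{\rm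 a}\left(\frac12-e^{\alpha(j-N_{\rm a})}\right)^2\right)\right),$$ the corresponding upper bound being the trivial bound $1$.
   Context: Model of multi-agent debate: an agent given only the query answers correctly with probability $p$; an agent that also sees the previous round's answers (memories), of which $N_{\rm e}$ are erroneous, answers correctly with probability $e^{-\alpha N_{\rm e}}$, where $\alpha>0$ is a constant coefficient indicating the robustness of agents to erroneous memories. With $j$ correct answers in round 1 one has $N_{\rm e}=N_{\rm a}-j$. The debate is deemed successful when strictly more than half of the final-round answers are correct. In the case conditions (i) and (ii), $j$ denotes the number of correct round-1 answers; inside the sums $j$ is the summation index. The condition $e^{\alpha(j-N_{\rm a})}<\frac12$ is equivalent to $j<N_{\rm a}-\frac{\ln 2}{\alpha}$, and $e^{\alpha(j-N_{\rm a})}\ge\frac12$ to $j\ge N_{\rm a}-\frac{\ln 2}{\alpha}$. Conventions: $0^0=1$, and sums range only over indices in $\{0,1,\dots,N_{\rm a}\}$. *)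

theory Defs
  imports "HOL-Probability.Probability"
begin

definition num_correct :: "nat \<Rightarrow> (nat \<Rightarrow> 'a \<Rightarrow> bool) \<Rightarrow> 'a \<Rightarrow> nat" where
  "num_correct N A w = card {i. i < N \<and> A i w}"

text \<open>
  \<open>A1 i\<close> and \<open>A2 i\<close> say whether agent \<open>i < N\<close> answers correctly in round 1 and in round 2.
  Conditioning on the event that round 1 has exactly \<open>j\<close> correct answers is rendered by
  \<^const>\<open>uniform_measure\<close>, which is the conditional probability measure; values \<open>j\<close> attained
  with probability 0 (possible when \<open>p\<close> is 0 or 1) are not constrained.
\<close>
locale two_round_debate = prob_space M
  for M :: "'a measure" +
  fixes N :: nat and p \<alpha> :: real and A1 A2 :: "nat \<Rightarrow> 'a \<Rightarrow> bool"
  assumes round1_indep: "indep_vars (\<lambda>_. count_space UNIV) A1 {..<N}"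
    and round1_prob: "\<And>i. i < N \<Longrightarrow> prob {w \<in> space M. A1 i w} = p"
    and round2_measurable: "\<And>i. i < N \<Longrightarrow> random_variable (count_space UNIV) (A2 i)"
    and round2_indep: "\<And>j. prob {w \<in> space M. num_correct N A1 w = j} > 0 \<Longrightarrow>
      prob_space.indep_vars (uniform_measure M {w \<in> space M. num_correct N A1 w = j})
        (\<lambda>_. count_space UNIV) A2 {..<N}"
    and round2_prob: "\<And>i j. i < N \<Longrightarrow> prob {w \<in> space M. num_correct N A1 w = j} > 0 \<Longrightarrow>
      measure (uniform_measure M {w \<in> space M. num_correct N A1 w = j}) {w \<in> space M. A2 i w}
        = exp (- \<alpha> * (real N - real j))"

definition debate_weight :: "nat \<Rightarrow> real \<Rightarrow> nat \<Rightarrow> real" where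
  "debate_weight N p j = real (N choose j) * p ^ j * (1 - p) ^ (N - j)"

text \<open>The threshold is an integer because it can be negative for small \<open>\<alpha>\<close>.\<close>
definition jstar :: "nat \<Rightarrow> real \<Rightarrow> int" where
  "jstar N \<alpha> = \<lfloor>real N - ln 2 / \<alpha>\<rfloor>"

end

theory Submission
  imports Defs
begin

text \<open>
  Condition on the number \<open>j\<close> of correct answers in round 1, which is binomially distributed.
  Given \<open>j\<close>, the number of correct answers in round 2 is a sum of \<open>N\<close> independent indicators of
  mean \<open>q = exp (\<alpha> (j - N))\<close>, and \<open>j \<le> j\<^sup>*\<close> holds iff \<open>q \<le> 1/2\<close>. Hoeffding's inequality with deviation
  \<open>N \<bar>1/2 - q\<bar>\<close> then bounds the conditional probability of a correct majority from above if
  \<open>j \<le> j\<^sup>*\<close>, and that of its complement if \<open>j > j\<^sup>*\<close>. The remaining conditional probabilities are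
  bounded by 1 and 0, respectively.
\<close>

text \<open>Links the cardinality to a sum of indicators, the form in which both measurability and
  Hoeffding's inequality apply.\<close>

lemma num_correct_eq_sum: "real (num_correct N A w) = (\<Sum>i<N. of_bool (A i w))"
proof -
  have "{i. i < N \<and> A i w} = {..<N} \<inter> {i. A i w}"
    by auto
  then show ?thesis
    by (simp add: num_correct_def of_bool_def sum.If_cases)
qed

lemma num_correct_le: "num_correct N A w \<le> N"
proof -
  have "card {i. i < N \<and> A i w} \<le> card {..<N}"
    by (intro card_mono) auto
  then show ?thesis
    by (simp add: num_correct_def)
qed

lemma measurable_num_correct:
  assumes "\<And>i. i < N \<Longrightarrow> A i \<in> measurable M (count_space UNIV)"
  shows "num_correct N A \<in> measurable M (count_space UNIV)"
proof -
  have [measurable]: "A i \<in> measurable M (count_space UNIV)" if "i \<in> {..<N}" for i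
    using assms that by simp
  have "real (num_correct N A w) = real (\<Sum>i<N. of_bool (A i w))" for w
    by (simp add: num_correct_eq_sum)
  then have "num_correct N A = (\<lambda>w. \<Sum>i<N. of_bool (A i w))"
    by (simp only: of_nat_eq_iff fun_eq_iff simp_thms)
  also have "(\<lambda>w. \<Sum>i<N. of_bool (A i w) :: nat) \<in> measurable M (count_space UNIV)"
    by measurable
  finally show ?thesis .
qed

context prob_space
begin

text \<open>The event splits according to the exact set of correct agents. By independence every
  such set of size \<open>j\<close> has the same probability, so the number of
  \<open>j\<close>-subsets appears as a factor.\<close>

lemma prob_num_correct_eq:
  assumes indep: "indep_vars (\<lambda>_. count_space UNIV) A {..<N}"
    and prob: "\<And>i. i < N \<Longrightarrow> prob {w \<in> space M. A i w} = p"
    and "N \<ge> 1"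
  shows "prob {w \<in> space M. num_correct N A w = j} = real (N choose j) * p ^ j * (1 - p) ^ (N - j)"
proof -
  \<comment> \<open>\<open>E S\<close> says that precisely the agents in \<open>S\<close> are
    correct: the truth value of each \<open>A i\<close> is required to equal that of
    \<open>i \<in> S\<close>. For \<open>N = 0\<close> this empty intersection would be
    \<open>UNIV\<close> instead of \<open>space M\<close>.\<close>
  define E where "E S = (\<Inter>i\<in>{..<N}. A i -` {i \<in> S} \<inter> space M)" for S
  define T where "T = {S. S \<subseteq> {..<N} \<and> card S = j}"
  have rv: "random_variable (count_space UNIV) (A i)" if "i < N" for i
    using indep that by (auto simp: indep_vars_def)
  have ev: "A i -` B \<inter> space M \<in> events" if "i < N" for i B
    using rv[OF that] by (rule measurable_sets) simp
  have E_iff: "w \<in> E S \<longleftrightarrow> w \<in> space M \<and> S = {i. i < N \<and> A i w}"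
    if "S \<subseteq> {..<N}" for w S
    using that \<open>N \<ge> 1\<close> by (auto simp: E_def lessThan_empty_iff)
  have [simp]: "finite T"
    by (auto simp: T_def intro: finite_subset[of _ "Pow {..<N}"])
  have E_prob: "prob (E S) = p ^ j * (1 - p) ^ (N - j)" if "S \<in> T" for S
  proof -
    have S: "S \<subseteq> {..<N}" "card S = j" "finite S"
      using that by (auto simp: T_def intro: finite_subset)
    have True_prob: "prob (A i -` {True} \<inter> space M) = p" if "i < N" for i
      using prob[OF that] by (auto simp: vimage_def Collect_conj_eq Int_commute)
    have False_prob: "prob (A i -` {False} \<inter> space M) = 1 - p" if "i < N" for i
    proof -
      have "A i -` {False} \<inter> space M = space M - A i -` {True} \<inter> space M"
        by auto
      then show ?thesis
        using prob_compl[OF ev[OF that]] True_prob[OF that] by simp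
    qed
    have "prob (E S) = (\<Prod>i<N. prob (A i -` {i \<in> S} \<inter> space M))"
      unfolding E_def using \<open>N \<ge> 1\<close> by (intro indep_varsD_finite[OF indep]) (auto simp: lessThan_empty_iff)
    also have "\<dots> = (\<Prod>i<N. if i \<in> S then p else 1 - p)"
      using True_prob False_prob by (intro prod.cong) auto
    also have "\<dots> = p ^ card ({..<N} \<inter> S) * (1 - p) ^ card ({..<N} \<inter> - S)"
      by (simp add: prod.If_cases)
    also have "{..<N} \<inter> S = S"
      using S by auto
    also have "{..<N} \<inter> - S = {..<N} - S"
      by auto
    finally show ?thesis
      using S by (simp add: card_Diff_subset)
  qed
  have "{w \<in> space M. num_correct N A w = j} = (\<Union>S\<in>T. E S)"
    by (auto simp: T_def E_iff num_correct_def)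
  moreover have "E S \<in> events" for S
    unfolding E_def using \<open>N \<ge> 1\<close> ev by (intro sets.finite_INT) (auto simp: lessThan_empty_iff)
  moreover have "disjoint_family_on E T"
    by (auto simp: disjoint_family_on_def T_def E_iff)
  ultimately have "prob {w \<in> space M. num_correct N A w = j} = (\<Sum>S\<in>T. prob (E S))"
    by (simp add: finite_measure_finite_Union image_subset_iff)
  also have "\<dots> = real (N choose j) * (p ^ j * (1 - p) ^ (N - j))"
    using n_subsets[of "{..<N}" j] by (simp add: E_prob T_def)
  finally show ?thesis
    by simp
qed

text \<open>The indicators lie in [0,1], so the squared interval widths add up to \<open>N\<close>.
  A deviation \<epsilon> from the mean \<open>N * q\<close> then has exponent -2 \<epsilon>^2 /
  \<open>N\<close>, and the majority threshold \<open>N / 2\<close> lies at distance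
  \<open>N * \<bar>1 / 2 - q\<bar>\<close> from that mean.\<close>

lemma num_correct_Hoeffding:
  assumes indep: "indep_vars (\<lambda>_. count_space UNIV) A {..<N}"
    and prob: "\<And>i. i < N \<Longrightarrow> prob {w \<in> space M. A i w} = q"
    and "N \<ge> 1"
  shows prob_majority_le: "q \<le> 1 / 2 \<Longrightarrow>
      prob {w \<in> space M. real (num_correct N A w) > real N / 2} \<le> exp (- 2 * real N * (1 / 2 - q)\<^sup>2)"
    and prob_majority_ge: "q \<ge> 1 / 2 \<Longrightarrow>
      prob {w \<in> space M. real (num_correct N A w) > real N / 2} \<ge> 1 - exp (- 2 * real N * (1 / 2 - q)\<^sup>2)"
proof -
  define X :: "nat \<Rightarrow> 'a \<Rightarrow> real" where "X i w = of_bool (A i w)" for i w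
  have rv: "random_variable (count_space UNIV) (A i)" if "i < N" for i
    using indep that by (auto simp: indep_vars_def)
  have expect: "expectation (X i) = q" if "i < N" for i
  proof -
    have [measurable]: "random_variable (count_space UNIV) (A i)"
      using rv that .
    have "expectation (X i) = expectation (indicator {w \<in> space M. A i w})"
      by (intro Bochner_Integration.integral_cong) (auto simp: X_def indicator_def)
    also have "\<dots> = prob ({w \<in> space M. A i w} \<inter> space M)"
      by (rule Bochner_Integration.integral_indicator)
    also have "{w \<in> space M. A i w} \<inter> space M = {w \<in> space M. A i w}"
      by auto
    also note prob[OF that]
    finally show ?thesis .
  qed
  have indep_X: "indep_vars (\<lambda>_. borel) X {..<N}"
    unfolding X_def by (rule indep_vars_compose2[OF indep]) simp
  interpret Hoeffding_ineq M "{..<N}" X "\<lambda>_. 0" "\<lambda>_. 1" "\<Sum>i<N. expectation (X i)"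
    using indep_X by unfold_locales (auto simp: X_def)
  have mean: "(\<Sum>i<N. expectation (X i)) = real N * q"
    by (simp add: expect)
  have sum_X: "(\<Sum>i<N. X i w) = real (num_correct N A w)" for w
    by (simp add: X_def num_correct_eq_sum)
  have [measurable]: "num_correct N A \<in> measurable M (count_space UNIV)"
    using rv by (rule measurable_num_correct)
  have expo: "- 2 * (real N * (1 / 2 - q))\<^sup>2 / real N = - 2 * real N * (1 / 2 - q)\<^sup>2"
    using \<open>N \<ge> 1\<close> by (simp add: power2_eq_square)
  show "prob {w \<in> space M. real (num_correct N A w) > real N / 2} \<le> exp (- 2 * real N * (1 / 2 - q)\<^sup>2)"
    if "q \<le> 1 / 2"
  proof -
    \<comment> \<open>Hoeffding's inequality bounds the closed tail, which contains the strict
      majority. The assumption on \<open>q\<close> makes the deviation nonnegative.\<close>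
    have "prob {w \<in> space M. real (num_correct N A w) > real N / 2}
        \<le> prob {w \<in> space M. real (num_correct N A w) \<ge> real N / 2}"
      by (intro finite_measure_mono) auto
    also have "\<dots> \<le> exp (- 2 * (real N * (1 / 2 - q))\<^sup>2 / real N)"
      using Hoeffding_ineq_ge[of "real N * (1 / 2 - q)"] that \<open>N \<ge> 1\<close>
      by (simp add: mean sum_X right_diff_distrib)
    finally show ?thesis
      by (simp only: expo)
  qed
  show "prob {w \<in> space M. real (num_correct N A w) > real N / 2} \<ge> 1 - exp (- 2 * real N * (1 / 2 - q)\<^sup>2)"
    if "q \<ge> 1 / 2"
  proof -
    \<comment> \<open>Ties count as failure, so the closed lower tail is exactly the complement of a
      strict majority.\<close>
    have "prob {w \<in> space M. real (num_correct N A w) \<le> real N / 2}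
        \<le> exp (- 2 * (real N * (q - 1 / 2))\<^sup>2 / real N)"
      using Hoeffding_ineq_le[of "real N * (q - 1 / 2)"] that \<open>N \<ge> 1\<close>
      by (simp add: mean sum_X right_diff_distrib)
    also have "(real N * (q - 1 / 2))\<^sup>2 = (real N * (1 / 2 - q))\<^sup>2"
      by (simp add: power2_eq_square algebra_simps)
    finally have "prob {w \<in> space M. real (num_correct N A w) \<le> real N / 2}
        \<le> exp (- 2 * real N * (1 / 2 - q)\<^sup>2)"
      by (simp only: expo)
    moreover have "prob {w \<in> space M. \<not> real (num_correct N A w) > real N / 2}
        = 1 - prob {w \<in> space M. real (num_correct N A w) > real N / 2}"
      by (intro prob_neg) auto
    ultimately show ?thesis
      by (simp add: not_less)
  qed
qed

end

text \<open>An integer is at most a floor iff it is at most the real number itself; multiplying by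
  \<open>\<alpha> > 0\<close> and exponentiating does the rest. The boundary value 1/2 falls on the
  side \<open>j \<le> j\<^sup>*\<close>.\<close>

lemma le_jstar_iff:
  assumes "\<alpha> > 0"
  shows "int j \<le> jstar N \<alpha> \<longleftrightarrow> exp (\<alpha> * (real j - real N)) \<le> 1 / 2"
proof -
  have "int j \<le> jstar N \<alpha> \<longleftrightarrow> real j \<le> real N - ln 2 / \<alpha>"
    by (simp add: jstar_def le_floor_iff)
  also have "\<dots> \<longleftrightarrow> \<alpha> * (real j - real N) \<le> ln (1 / 2)"
    using assms by (simp add: field_simps ln_div)
  also have "\<dots> \<longleftrightarrow> exp (\<alpha> * (real j - real N)) \<le> 1 / 2"
    by (subst ln_ge_iff [symmetric, of "1/2"]) (auto simp: ln_ge_iff)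
  finally show ?thesis .
qed

text \<open>Both bounds come from one decomposition of \<open>P\<close>, split at
  \<open>j\<^sup>*\<close>; each uses Hoeffding's inequality on one half only. The index sets
  compare integers, so a negative \<open>j\<^sup>*\<close> just leaves the first sum empty.\<close>

lemma (in two_round_debate) majority_bounds:
  assumes "N \<ge> 1" and "\<alpha> > 0"
  defines "P \<equiv> prob {w \<in> space M. real (num_correct N A2 w) > real N / 2}"
    and "h \<equiv> \<lambda>j. exp (- 2 * real N * (1 / 2 - exp (\<alpha> * (real j - real N)))\<^sup>2)"
  shows "P \<le> (\<Sum>j\<in>{j\<in>{0..N}. int j \<le> jstar N \<alpha>}. debate_weight N p j * h j)
            + (\<Sum>j\<in>{j\<in>{0..N}. jstar N \<alpha> + 1 \<le> int j}. debate_weight N p j)" (is "_ \<le> ?U")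
    and "(\<Sum>j\<in>{j\<in>{0..N}. jstar N \<alpha> + 1 \<le> int j}. debate_weight N p j * (1 - h j)) \<le> P"
      (is "?L \<le> _")
proof -
  define maj where "maj = {w \<in> space M. real (num_correct N A2 w) > real N / 2}"
  define B where "B j = {w \<in> space M. num_correct N A1 w = j}" for j
  define q where "q j = exp (\<alpha> * (real j - real N))" for j
  have [measurable]: "num_correct N A1 \<in> measurable M (count_space UNIV)"
    using round1_indep by (intro measurable_num_correct) (auto simp: indep_vars_def)
  have [measurable]: "num_correct N A2 \<in> measurable M (count_space UNIV)"
    using round2_measurable by (rule measurable_num_correct)
  have maj_ev [measurable]: "maj \<in> events"
    unfolding maj_def by measurable
  have B_ev [measurable]: "B j \<in> events" for j
    unfolding B_def by measurable
  have B_prob: "prob (B j) = debate_weight N p j" for j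
    unfolding B_def debate_weight_def
    using round1_indep round1_prob \<open>N \<ge> 1\<close> by (rule prob_num_correct_eq)
  have "P = (\<Sum>j\<in>{0..N}. prob (maj \<inter> B j))"
  proof -
    \<comment> \<open>The events \<open>B 0\<close>, ..., \<open>B N\<close> cover the space because
      the count never exceeds \<open>N\<close>.\<close>
    have "maj = (\<Union>j\<in>{0..N}. maj \<inter> B j)"
      using num_correct_le[of N A1] by (auto simp: maj_def B_def)
    moreover have "prob (\<Union>j\<in>{0..N}. maj \<inter> B j) = (\<Sum>j\<in>{0..N}. prob (maj \<inter> B j))"
      by (intro finite_measure_finite_Union) (auto simp: disjoint_family_on_def B_def)
    ultimately have "prob maj = (\<Sum>j\<in>{0..N}. prob (maj \<inter> B j))"
      by metis
    then show ?thesis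
      by (simp only: P_def maj_def)
  qed
  also have "\<dots> = (\<Sum>j\<in>{j\<in>{0..N}. int j \<le> jstar N \<alpha>}. prob (maj \<inter> B j))
                 + (\<Sum>j\<in>{j\<in>{0..N}. jstar N \<alpha> + 1 \<le> int j}. prob (maj \<inter> B j))"
    by (subst sum.union_disjoint [symmetric]) (auto intro!: sum.cong)
  finally have P_eq: "P = \<dots>" .

  \<comment> \<open>Joint probabilities are used so that the claim also makes sense when
    \<open>B j\<close> is a null event and round 2 is unconstrained: then the weight and the joint
    probability both vanish.\<close>
  have cond: "(q j \<le> 1 / 2 \<longrightarrow> prob (maj \<inter> B j) \<le> debate_weight N p j * h j) \<and>
      (q j \<ge> 1 / 2 \<longrightarrow> debate_weight N p j * (1 - h j) \<le> prob (maj \<inter> B j))" for j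
  proof (cases "prob (B j) > 0")
    case False
    then have "prob (B j) = 0"
      using measure_nonneg[of M "B j"] by linarith
    moreover have "prob (maj \<inter> B j) \<le> prob (B j)"
      by (intro finite_measure_mono) auto
    ultimately show ?thesis
      by (simp flip: B_prob)
  next
    case True
    \<comment> \<open>Under the conditional measure, round 2 consists of independent answers, each
      correct with probability \<open>q j\<close>, so the Hoeffding bounds apply inside
      \<open>C\<close>. Multiplying by \<open>prob (B j)\<close> returns to
      \<open>M\<close>.\<close>
    define C where "C = uniform_measure M (B j)"
    have emeasure_B: "emeasure M (B j) \<noteq> 0" "emeasure M (B j) \<noteq> \<infinity>"
      using True by (auto simp: emeasure_eq_measure)
    interpret C: prob_space C
      unfolding C_def using emeasure_B by (rule prob_space_uniform_measure)
    have [simp]: "space C = space M"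
      by (simp add: C_def)
    have indep: "C.indep_vars (\<lambda>_. count_space UNIV) A2 {..<N}"
      using round2_indep[of j] True by (simp add: C_def B_def)
    have prob: "C.prob {w \<in> space C. A2 i w} = q j" if "i < N" for i
      using round2_prob[OF that, of j] True by (simp add: C_def B_def q_def algebra_simps)
    have "C.prob maj = prob (B j \<inter> maj) / prob (B j)"
      unfolding C_def using emeasure_B maj_ev by (intro measure_uniform_measure)
    then have "prob (maj \<inter> B j) = prob (B j) * C.prob maj"
      using True by (simp add: Int_commute)
    moreover have "q j \<le> 1 / 2 \<Longrightarrow> C.prob maj \<le> h j"
      using C.prob_majority_le[OF indep prob \<open>N \<ge> 1\<close>] by (simp add: maj_def h_def q_def)
    moreover have "q j \<ge> 1 / 2 \<Longrightarrow> 1 - h j \<le> C.prob maj"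
      using C.prob_majority_ge[OF indep prob \<open>N \<ge> 1\<close>] by (simp add: maj_def h_def q_def)
    ultimately show ?thesis
      using True by (simp flip: B_prob)
  qed
  have q_iff: "int j \<le> jstar N \<alpha> \<longleftrightarrow> q j \<le> 1 / 2" for j
    unfolding q_def using \<open>\<alpha> > 0\<close> by (rule le_jstar_iff)
  have q_gt: "q j > 1 / 2" if "jstar N \<alpha> + 1 \<le> int j" for j
    using q_iff[of j] that by linarith

  show "P \<le> ?U"
    unfolding P_eq
  proof (intro add_mono sum_mono)
    show "prob (maj \<inter> B j) \<le> debate_weight N p j * h j"
      if "j \<in> {j\<in>{0..N}. int j \<le> jstar N \<alpha>}" for j
      using that cond[of j] q_iff[of j] by blast
    show "prob (maj \<inter> B j) \<le> debate_weight N p j" for j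
      unfolding B_prob [symmetric] by (intro finite_measure_mono) auto
  qed
  have "?L \<le> (\<Sum>j\<in>{j\<in>{0..N}. jstar N \<alpha> + 1 \<le> int j}. prob (maj \<inter> B j))"
    using cond q_gt by (intro sum_mono) (auto simp: less_imp_le)
  \<comment> \<open>The terms with \<open>j \<le> j\<^sup>*\<close> are nonnegative and are
    dropped.\<close>
  also have "\<dots> \<le> P"
    unfolding P_eq by (simp add: sum_nonneg)
  finally show "?L \<le> P" .
qed

theorem proposition2p3:
  fixes M :: "'a measure" and N :: nat and p \<alpha> :: real
    and A1 A2 :: "nat \<Rightarrow> 'a \<Rightarrow> bool"
  assumes "N \<ge> 1" and "0 \<le> p" and "p \<le> 1" and "\<alpha> > 0"
    and "two_round_debate M N p \<alpha> A1 A2"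
  shows "let P = measure M {w \<in> space M. real (num_correct N A2 w) > real N / 2} in
    (\<forall>j\<in>{0..N}. exp (\<alpha> * (real j - real N)) < 1 / 2 \<longrightarrow>
      0 \<le> P \<and>
      P \<le> (\<Sum>j\<in>{j\<in>{0..N}. int j \<le> jstar N \<alpha>}.
              debate_weight N p j *
              exp (- 2 * real N * (1 / 2 - exp (\<alpha> * (real j - real N)))\<^sup>2))
          + (\<Sum>j\<in>{j\<in>{0..N}. jstar N \<alpha> + 1 \<le> int j}. debate_weight N p j)) \<and>
    (\<forall>j\<in>{0..N}. exp (\<alpha> * (real j - real N)) \<ge> 1 / 2 \<longrightarrow>
      (\<Sum>j\<in>{j\<in>{0..N}. jstar N \<alpha> + 1 \<le> int j}.
          debate_weight N p j *
          (1 - exp (- 2 * real N * (1 / 2 - exp (\<alpha> * (real j - real N)))\<^sup>2))) \<le> P \<and>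
      P \<le> 1)"
proof -
  interpret two_round_debate M N p \<alpha> A1 A2
    by (fact assms(5))
  show ?thesis
    unfolding Let_def
    using majority_bounds[OF \<open>N \<ge> 1\<close> \<open>\<alpha> > 0\<close>] by (auto simp: prob_le_1)
qed

end
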